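(* Let $P$ be a finite poset on $[d]$. Then every edge partition of $P$ is integral (i.e. for every edge partition $\ell$ of $P$ the order-chain polytope $\mathcal{OC}_\ell(P)$ has all its vertices in $\mathbb{Z}^d$) if and only if the Hasse diagram of $P$ is an acyclic graph.
   Context: For a finite poset $(P,\preccurlyeq)$ on $[d]=\{1,\dots,d\}$: the order polytope $\mathcal{O}(P)$ is the set of $(x_1,\dots,x_d)\in\mathbb{R}^d$ with $0\le x_i\le 1$ for all $i$ and $x_i\ge x_j$ whenever $i\preccurlyeq j$ in $P$. The chain polytope $\mathcal{C}(P)$ is the set of $(x_1,\dots,x_d)\in\mathbb{R}^d$ with $x_i\ge 0$ for all $i$ and $x_{i_1}+\dots+x_{i_k}\le 1$ for every maximal chain $i_1\prec\dots\prec i_k$ of $P$. Let $E(P)$ be the set of edges of the Hasse diagram of $P$ (each cover relation $i\prec j$ gives an edge $\{i,j\}$). An edge partition of $P$ is an ordered pair $\ell=(oE(P),cE(P))$ of disjoint subsets of $E(P)$ with union $E(P)$. Let $P'_\ell$ (resp. $P''_\ell$) be the poset on $[d]$ whose Hasse diagram has edge set $oE(P)$ (resp. $cE(P)$), i.e. the order generated by these cover relations of $P$. The order-chain polytope is $\mathcal{OC}_\ell(P)=\mathcal{O}(P'_\ell)\cap\mathcal{C}(P''_\ell)\subset\mathbb{R}^d$. The edge partition $\ell$ is called integral if $\mathcal{OC}_\ell(P)$ is an integral polytope (all vertices have integer coordinates). *)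

theory Defs
  imports "HOL-Analysis.Analysis"
begin

text \<open>
  The ground set [d] is the universe of a finite type 'n (with d = CARD('n)), so that
  d-dimensional space is the type real ^ 'n.  A partial order r on it is a relation satisfying
  partial_order_on UNIV r, where (i, j) : r means that i is below or equal to j.
\<close>

definition order_polytope :: "('n::finite) rel \<Rightarrow> (real ^ 'n) set" where
  "order_polytope r =
     {x. (\<forall>i. 0 \<le> x $ i \<and> x $ i \<le> 1) \<and> (\<forall>i j. (i, j) \<in> r \<longrightarrow> x $ i \<ge> x $ j)}"

definition maximal_chain :: "'a rel \<Rightarrow> 'a set \<Rightarrow> bool" where
  "maximal_chain r C \<longleftrightarrow> C \<in> Chains r \<and> (\<forall>D \<in> Chains r. C \<subseteq> D \<longrightarrow> D = C)"

definition chain_polytope :: "('n::finite) rel \<Rightarrow> (real ^ 'n) set" where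
  "chain_polytope r =
     {x. (\<forall>i. 0 \<le> x $ i) \<and> (\<forall>C. maximal_chain r C \<longrightarrow> (\<Sum>i\<in>C. x $ i) \<le> 1)}"

definition cover_relation :: "'a rel \<Rightarrow> 'a rel" where
  "cover_relation r =
     {(i, j). (i, j) \<in> r \<and> i \<noteq> j \<and>
        \<not> (\<exists>k. k \<noteq> i \<and> k \<noteq> j \<and> (i, k) \<in> r \<and> (k, j) \<in> r)}"

definition hasse_edges :: "'a rel \<Rightarrow> 'a set set" where
  "hasse_edges r = {{i, j} | i j. (i, j) \<in> cover_relation r}"

definition edge_partition :: "'a rel \<Rightarrow> 'a set set \<times> 'a set set \<Rightarrow> bool" where
  "edge_partition r l \<longleftrightarrow> fst l \<inter> snd l = {} \<and> fst l \<union> snd l = hasse_edges r"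

text \<open>The order whose Hasse diagram consists of the edges in F of the Hasse diagram of r.\<close>

definition generated_order :: "'a rel \<Rightarrow> 'a set set \<Rightarrow> 'a rel" where
  "generated_order r F = {(i, j) \<in> cover_relation r. {i, j} \<in> F}\<^sup>*"

definition order_chain_polytope ::
  "('n::finite) rel \<Rightarrow> 'n set set \<times> 'n set set \<Rightarrow> (real ^ 'n) set" where
  "order_chain_polytope r l =
     order_polytope (generated_order r (fst l)) \<inter> chain_polytope (generated_order r (snd l))"

text \<open>The vertices of a polytope are its extreme points.\<close>

definition integral_polytope :: "(real ^ 'n::finite) set \<Rightarrow> bool" where
  "integral_polytope S \<longleftrightarrow> polytope S \<and> (\<forall>v. v extreme_point_of S \<longrightarrow> (\<forall>i. v $ i \<in> \<int>))"

definition integral_edge_partition ::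
  "('n::finite) rel \<Rightarrow> 'n set set \<times> 'n set set \<Rightarrow> bool" where
  "integral_edge_partition r l \<longleftrightarrow> integral_polytope (order_chain_polytope r l)"

text \<open>
  Simple undirected graphs are given by their set of two-element edges.  A cycle is listed by its
  pairwise distinct vertices, of which there are at least three; the index taken modulo the length
  also covers the closing edge.  This is unrelated to the constant acyclic of HOL, which is about
  directed cycles (a Hasse diagram has none of these).
\<close>

definition graph_cycle :: "'a set set \<Rightarrow> 'a list \<Rightarrow> bool" where
  "graph_cycle E p \<longleftrightarrow> 3 \<le> length p \<and> distinct p \<and>
     (\<forall>k < length p. {p ! k, p ! (Suc k mod length p)} \<in> E)"

definition acyclic_graph :: "'a set set \<Rightarrow> bool" where
  "acyclic_graph E \<longleftrightarrow> \<not> (\<exists>p. graph_cycle E p)"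

end

theory Submission
  imports Defs
begin

text \<open>
  If the Hasse diagram has a cycle, let a single edge \<open>{a, b}\<close> of it be a chain edge and all other
  edges order edges.  The constant vector 1/2 shows that the face on which \<open>v a + v b = 1\<close> and all
  order inequalities are tight is nonempty; going round the cycle gives \<open>v a = v b\<close>, hence
  \<open>v a = 1/2\<close>, on this face, so its vertices are not integral.

  If the Hasse diagram is a forest and \<open>x\<close> is a vertex, attach to each \<open>i\<close> an arc of length \<open>x i\<close> on
  the circle of circumference 1, such that the arcs of a chain are disjoint and such that arcs joined
  by an order edge start at the same point.  Only differences of starting points along edges are
  prescribed, so on a forest this is possible.  The indicator vector of the arcs that contain a
  given point of the circle lies in the polytope and is tight wherever \<open>x\<close> is, so it equals \<open>x\<close>.
\<close>

section \<open>Extreme points of polyhedra\<close>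

text \<open>If \<open>y\<close> differed from \<open>x\<close>, the segment from \<open>y\<close> to
  \<open>x\<close> could be prolonged a little beyond \<open>x\<close>: constraints tight at
  \<open>x\<close> stay constant along the line and slack ones survive a small move, so
  \<open>x\<close> would be interior to a segment of the polyhedron.\<close>

lemma extreme_point_eq_if_tight:
  fixes H :: "('a::real_inner \<times> real) set"
  assumes fin: "finite H"
    and ext: "x extreme_point_of {v. \<forall>(a, b)\<in>H. a \<bullet> v \<le> b}"
    and y: "\<forall>(a, b)\<in>H. a \<bullet> y \<le> b"
    and tight: "\<And>a b. (a, b) \<in> H \<Longrightarrow> a \<bullet> x = b \<Longrightarrow> a \<bullet> y = b"
  shows "y = x"
proof (rule ccontr)
  assume ne: "y \<noteq> x"
  let ?w = "\<lambda>e. x - e *\<^sub>R (y - x)"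
  have x: "a \<bullet> x \<le> b" if "(a, b) \<in> H" for a b
    using ext that unfolding extreme_point_of_def by blast
  have "\<forall>\<^sub>F e in at_right 0. fst h \<bullet> ?w e \<le> snd h" if "h \<in> H" for h
  proof -
    obtain a b where h: "h = (a, b)" by (cases h)
    show ?thesis
    proof (cases "a \<bullet> x = b")
      case True
      then have "a \<bullet> y = b" using tight that h by blast
      with True show ?thesis by (simp add: h inner_diff_right)
    next
      case False
      with x that h have "a \<bullet> x < b" by fastforce
      moreover have "((\<lambda>e. a \<bullet> ?w e) \<longlongrightarrow> a \<bullet> ?w 0) (at_right 0)"
        by (intro tendsto_intros)
      ultimately have "\<forall>\<^sub>F e in at_right 0. a \<bullet> ?w e < b"
        by (intro order_tendstoD(2)) auto
      then show ?thesis by eventually_elim (simp add: h)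
    qed
  qed
  then have "\<forall>\<^sub>F e in at_right 0. \<forall>h\<in>H. fst h \<bullet> ?w e \<le> snd h"
    using fin by (simp add: eventually_ball_finite)
  moreover have "\<forall>\<^sub>F e in at_right (0::real). 0 < e"
    by (simp add: eventually_at_right_less)
  ultimately have "\<forall>\<^sub>F e in at_right 0. 0 < e \<and> (\<forall>h\<in>H. fst h \<bullet> ?w e \<le> snd h)"
    by eventually_elim simp
  then obtain e where e: "0 < e" and w: "\<forall>h\<in>H. fst h \<bullet> ?w e \<le> snd h"
    using eventually_happens[of _ "at_right (0::real)"] by auto
  have ne': "?w e \<noteq> y"
  proof
    assume "?w e = y"
    then have "(1 + e) *\<^sub>R (y - x) = 0" by (simp add: algebra_simps)
    with e ne show False by simp
  qed
  \<comment> \<open>Going from \<open>?w e\<close> to \<open>y\<close> is a move by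
    \<open>(1 + e)\<close> times \<open>y - x\<close>, and \<open>x\<close> is reached after
    \<open>e\<close> of these units; hence the weight \<open>e / (1 + e)\<close>.\<close>
  have "x = (1 - e / (1 + e)) *\<^sub>R ?w e + (e / (1 + e)) *\<^sub>R y"
  proof -
    have "(1 + e) *\<^sub>R ((1 - e / (1 + e)) *\<^sub>R ?w e + (e / (1 + e)) *\<^sub>R y) =
        ((1 + e) * (1 - e / (1 + e))) *\<^sub>R ?w e + ((1 + e) * (e / (1 + e))) *\<^sub>R y"
      by (simp only: scaleR_add_right scaleR_scaleR)
    also have "\<dots> = ?w e + e *\<^sub>R y" using e by (simp add: field_simps)
    also have "\<dots> = (1 + e) *\<^sub>R x" by (simp add: algebra_simps)
    finally show ?thesis using e by simp
  qed
  with ne' e have "x \<in> open_segment (?w e) y"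
    by (auto simp: in_segment intro!: exI[of _ "e / (1 + e)"])
  moreover have "?w e \<in> {v. \<forall>(a, b)\<in>H. a \<bullet> v \<le> b}" using w by auto
  ultimately show False using ext y unfolding extreme_point_of_def by blast
qed

section \<open>Disjoint arcs along chains\<close>

lemma finite_chain_has_greatest:
  assumes "finite C" "C \<noteq> {}" "C \<in> Chains q" "refl q" "trans q"
  shows "\<exists>m\<in>C. \<forall>i\<in>C. (i, m) \<in> q"
  using assms
proof (induction C rule: finite_ne_induct)
  case (singleton a)
  then show ?case by (auto simp: refl_on_def)
next
  case (insert a C)
  then obtain m where m: "m \<in> C" "\<forall>i\<in>C. (i, m) \<in> q" by (auto simp: Chains_def)
  with insert.prems have "(a, m) \<in> q \<or> (m, a) \<in> q" by (auto simp: Chains_def)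
  then show ?case
  proof
    assume "(m, a) \<in> q"
    then have "(i, a) \<in> q" if "i \<in> insert a C" for i
      using that m insert.prems(2,3) transD[of q i m a] by (auto simp: refl_on_def)
    then show ?thesis by blast
  qed (use m in blast)
qed

lemma finite_chain_has_least:
  assumes "finite C" "C \<noteq> {}" "C \<in> Chains q" "refl q" "trans q"
  shows "\<exists>m\<in>C. \<forall>i\<in>C. (m, i) \<in> q"
proof -
  have "C \<in> Chains (q\<inverse>)" using assms(3) by (auto simp: Chains_def)
  then show ?thesis using finite_chain_has_greatest[of C "q\<inverse>"] assms by simp
qed

text \<open>
  The intervals \<open>[z i, z i + x i)\<close> come from Stanley's transfer map: \<open>z m\<close> is the largest weight of
  a chain strictly below \<open>m\<close>.
\<close>

lemma chain_offsets:
  fixes q :: "('n::finite) rel" and x :: "'n \<Rightarrow> real"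
  assumes q: "refl q" "trans q" "antisym q"
    and nonneg: "\<And>i. 0 \<le> x i"
    and le1: "\<And>C. C \<in> Chains q \<Longrightarrow> sum x C \<le> 1"
  obtains z where "\<And>i. 0 \<le> z i" "\<And>i. z i + x i \<le> 1"
    "\<And>i j. (i, j) \<in> q \<Longrightarrow> i \<noteq> j \<Longrightarrow> z i + x i \<le> z j"
    "\<And>C t. C \<in> Chains q \<Longrightarrow> sum x C = 1 \<Longrightarrow> 0 \<le> t \<Longrightarrow> t < 1 \<Longrightarrow>
       \<exists>i\<in>C. z i \<le> t \<and> t < z i + x i"
proof -
  define below where "below m = {D \<in> Chains q. \<forall>i\<in>D. (i, m) \<in> q \<and> i \<noteq> m}" for m
  define z where "z m = Max (sum x ` below m)" for m
  have empty_below: "{} \<in> below m" for m by (simp add: below_def Chains_def)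
  have z_ge: "sum x D \<le> z m" if "D \<in> below m" for D m
    unfolding z_def using that by (intro Max_ge) auto
  have z_attained: "\<exists>D\<in>below m. z m = sum x D" for m
  proof -
    have "z m \<in> sum x ` below m" unfolding z_def using empty_below by (intro Max_in) auto
    then show ?thesis by auto
  qed
  \<comment> \<open>A heaviest chain strictly below \<open>m\<close> can be extended by any chain
    that starts at or above \<open>m\<close>, and the union still has weight at most 1.\<close>
  have up_le: "z m + sum x C \<le> 1" if C: "C \<in> Chains q" and m: "\<And>i. i \<in> C \<Longrightarrow> (m, i) \<in> q" for m C
  proof -
    obtain D where D: "D \<in> below m" "z m = sum x D" using z_attained by blast
    have "i \<noteq> j \<and> (i, j) \<in> q" if "i \<in> D" "j \<in> C" for i j
      using D m that q unfolding below_def by (metis (mono_tags, lifting) antisymD mem_Collect_eq transD)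
    with C D have "D \<union> C \<in> Chains q" "D \<inter> C = {}" by (auto simp: below_def Chains_def)
    then show ?thesis using le1[of "D \<union> C"] D by (simp add: sum.union_disjoint)
  qed
  have down_le: "sum x C \<le> z m + x m"
    if C: "C \<in> Chains q" "m \<in> C" and m: "\<And>i. i \<in> C \<Longrightarrow> (i, m) \<in> q" for m C
  proof -
    have "C - {m} \<in> below m" using C m by (auto simp: below_def Chains_def)
    from z_ge[OF this] C show ?thesis by (simp add: sum.remove)
  qed
  show thesis
  proof
    show "0 \<le> z i" for i using z_ge[OF empty_below] by simp
    show "z i + x i \<le> 1" for i
      using up_le[of "{i}" i] q by (simp add: Chains_def refl_on_def)
    show "z i + x i \<le> z j" if ij: "(i, j) \<in> q" "i \<noteq> j" for i j
    proof -
      obtain D where D: "D \<in> below i" "z i = sum x D" using z_attained by blast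
      have "(k, j) \<in> q \<and> k \<noteq> j" if "k \<in> D" for k
        using D that ij q unfolding below_def by (metis (mono_tags, lifting) antisymD mem_Collect_eq transD)
      moreover have "i \<notin> D" "insert i D \<in> Chains q"
        using D q by (auto simp: below_def Chains_def refl_on_def)
      ultimately show ?thesis using z_ge[of "insert i D" j] D ij by (simp add: below_def)
    qed
    show "\<exists>i\<in>C. z i \<le> t \<and> t < z i + x i"
      if C: "C \<in> Chains q" and sum1: "sum x C = 1" and t: "0 \<le> t" "t < 1" for C t
    proof (rule ccontr)
      assume none: "\<not> ?thesis"
      \<comment> \<open>If no interval of \<open>C\<close> contains \<open>t\<close>, those of
        \<open>L\<close> end by \<open>t\<close> and those of \<open>U\<close> start after
        \<open>t\<close>. The top of \<open>L\<close> and the bottom of \<open>U\<close> then bound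
        the two weights, giving a total below 1. For empty \<open>L\<close> or \<open>U\<close> the
        bounds are \<open>0 \<le> t\<close> and \<open>t < 1\<close>.\<close>
      define L where "L = {i \<in> C. z i \<le> t}"
      define U where "U = {i \<in> C. t < z i}"
      have LU: "L \<in> Chains q" "U \<in> Chains q" using C by (auto simp: L_def U_def Chains_def)
      have L: "sum x L \<le> t"
      proof (cases "L = {}")
        case False
        then obtain m where m: "m \<in> L" "\<forall>i\<in>L. (i, m) \<in> q"
          using finite_chain_has_greatest[of L q] LU q by auto
        then have "sum x L \<le> z m + x m" using down_le LU by blast
        then show ?thesis using none m by (force simp: L_def)
      qed (use t in simp)
      have U: "sum x U < 1 - t"
      proof (cases "U = {}")
        case False
        then obtain m where m: "m \<in> U" "\<forall>i\<in>U. (m, i) \<in> q"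
          using finite_chain_has_least[of U q] LU q by auto
        then have "z m + sum x U \<le> 1" using up_le LU by blast
        then show ?thesis using m by (force simp: U_def)
      qed (use t in simp)
      have "C = L \<union> U" "L \<inter> U = {}" by (auto simp: L_def U_def)
      then have "sum x C = sum x L + sum x U" by (simp add: sum.union_disjoint)
      with L U sum1 show False by simp
    qed
  qed
qed

text \<open>On the circle of circumference 1, \<open>frac (c - z)\<close> is the distance from
  \<open>z\<close> forward to \<open>c\<close>. The arc from \<open>z\<close> of length
  \<open>w\<close> does not run past 0, so membership of \<open>c\<close> can be read off from
  \<open>frac c\<close>.\<close>

lemma frac_diff_less_iff:
  fixes c z w :: real
  assumes "0 \<le> z" "z + w \<le> 1"
  shows "frac (c - z) < w \<longleftrightarrow> z \<le> frac c \<and> frac c < z + w"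
proof (cases "w \<le> 0")
  case True
  then have "\<not> frac (c - z) < w" using frac_ge_0[of "c - z"] by linarith
  with True show ?thesis by auto
next
  case False
  then have z: "z < 1" using assms by simp
  show ?thesis
  proof (cases "z \<le> frac c")
    case True
    have "frac (c - z) = frac c - z"
      using True assms frac_lt_1[of c] by (subst frac_unique_iff) (auto simp: frac_def)
    then show ?thesis using True by auto
  next
    case False
    \<comment> \<open>Here \<open>c\<close> lies before \<open>z\<close>, so the forward distance
      wraps around once; it is at least \<open>1 - z\<close>, hence at least
      \<open>w\<close>.\<close>
    have "frac (c - z) = frac c - z + 1"
    proof (subst frac_unique_iff, intro conjI)
      have "c - z - (frac c - z + 1) = of_int (\<lfloor>c\<rfloor> - 1)" by (simp add: frac_def)
      then show "c - z - (frac c - z + 1) \<in> \<int>" by (metis Ints_of_int)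
      show "0 \<le> frac c - z + 1" using z frac_ge_0[of c] by linarith
      show "frac c - z + 1 < 1" using False by simp
    qed
    moreover have "\<not> frac c - z + 1 < w" using assms frac_ge_0[of c] by linarith
    ultimately show ?thesis using False by simp
  qed
qed

section \<open>Paths, cycles and potentials on forests\<close>

text \<open>A walk is kept free of repetitions as it grows: when the next vertex already occurs, the
  path is cut off at that vertex.\<close>

lemma edge_path_if_connected:
  assumes "(a, b) \<in> {(u, v). {u, v} \<in> E}\<^sup>*"
  shows "\<exists>p. p \<noteq> [] \<and> distinct p \<and> hd p = a \<and> last p = b \<and>
    (\<forall>k. Suc k < length p \<longrightarrow> {p ! k, p ! Suc k} \<in> E)"
  using assms
proof (induction rule: rtrancl_induct)
  case base
  show ?case by (intro exI[of _ "[a]"]) auto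
next
  case (step b c)
  then obtain p where p: "p \<noteq> []" "distinct p" "hd p = a" "last p = b"
    "\<forall>k. Suc k < length p \<longrightarrow> {p ! k, p ! Suc k} \<in> E" by blast
  show ?case
  proof (cases "c \<in> set p")
    case True
    then obtain k where k: "k < length p" "p ! k = c" by (auto simp: in_set_conv_nth)
    let ?p = "take (Suc k) p"
    have "?p \<noteq> []" "hd ?p = a" using p by simp_all
    moreover have "distinct ?p" using p by (intro distinct_take)
    moreover have "last ?p = c" using k by (simp add: take_Suc_conv_app_nth)
    ultimately show ?thesis using p(5) k by (intro exI[of _ ?p]) auto
  next
    case False
    have "{(p @ [c]) ! k, (p @ [c]) ! Suc k} \<in> E" if "Suc k < length (p @ [c])" for k
    proof (cases "Suc k < length p")
      case True
      then show ?thesis using p(5) by (simp add: nth_append)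
    next
      case False
      with that have "Suc k = length p" by simp
      then show ?thesis using p step(2) by (auto simp: nth_append last_conv_nth dest!: sym[of "Suc k"])
    qed
    then show ?thesis using p False by (intro exI[of _ "p @ [c]"]) auto
  qed
qed

lemma acyclic_graph_mono: "acyclic_graph F \<Longrightarrow> E \<subseteq> F \<Longrightarrow> acyclic_graph E"
  unfolding acyclic_graph_def graph_cycle_def by blast

text \<open>The new edge would close a path from \<open>a\<close> to \<open>b\<close> to a cycle.
  Length 1 is excluded by \<open>a \<noteq> b\<close>, and length 2 because \<open>{a, b}\<close> is
  not yet an edge.\<close>

lemma acyclic_graph_not_connected:
  assumes acyc: "acyclic_graph (insert {a, b} E)" and new: "{a, b} \<notin> E" and ab: "a \<noteq> b"
  shows "(a, b) \<notin> {(u, v). {u, v} \<in> E}\<^sup>*"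
proof
  assume "(a, b) \<in> {(u, v). {u, v} \<in> E}\<^sup>*"
  then obtain p where p: "p \<noteq> []" "distinct p" "hd p = a" "last p = b"
    "\<forall>k. Suc k < length p \<longrightarrow> {p ! k, p ! Suc k} \<in> E"
    using edge_path_if_connected by metis
  have "length p \<noteq> 1"
  proof
    assume "length p = 1"
    then obtain c where "p = [c]" by (auto simp: length_Suc_conv)
    with p ab show False by simp
  qed
  moreover have "length p \<noteq> 2"
  proof
    assume len: "length p = 2"
    then have "p ! 0 = a" "p ! Suc 0 = b" using p by (auto simp: hd_conv_nth last_conv_nth)
    moreover have "{p ! 0, p ! Suc 0} \<in> E" using p(5) len by simp
    ultimately show False using new by simp
  qed
  moreover have "length p \<noteq> 0" using p by simp
  ultimately have len: "3 \<le> length p" by linarith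
  have "{p ! k, p ! (Suc k mod length p)} \<in> insert {a, b} E" if "k < length p" for k
  proof (cases "Suc k < length p")
    case True
    then show ?thesis using p(5) by simp
  next
    case False
    with that have k: "Suc k = length p" by simp
    then have "p ! k = b" using p by (metis diff_Suc_1 last_conv_nth)
    moreover have "p ! 0 = a" using p by (simp add: hd_conv_nth)
    ultimately show ?thesis using k by (simp add: insert_commute)
  qed
  then have "graph_cycle (insert {a, b} E) p" using len p by (simp add: graph_cycle_def)
  then show False using acyc unfolding acyclic_graph_def by blast
qed

text \<open>Edges are added one at a time. In a forest each new edge joins two different components,
  so shifting the potential on one side repairs the new difference and leaves the old ones alone.
  Disjointness of \<open>R\<close> and its converse keeps each undirected edge from being prescribed
  twice.\<close>

lemma forest_potential:
  fixes \<delta> :: "'a \<Rightarrow> 'a \<Rightarrow> real"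
  assumes "finite R" "irrefl R" "R \<inter> R\<inverse> = {}" "acyclic_graph {{i, j} | i j. (i, j) \<in> R}"
  shows "\<exists>s. \<forall>(i, j)\<in>R. s j - s i = \<delta> i j"
  using assms
proof (induction R rule: finite_induct)
  case empty
  show ?case by simp
next
  case (insert e R)
  obtain a b where e: "e = (a, b)" by (cases e)
  define E where "E = {{i, j} | i j. (i, j) \<in> R}"
  have E': "{{i, j} | i j. (i, j) \<in> insert e R} = insert {a, b} E" by (auto simp: e E_def)
  have ab: "a \<noteq> b" using insert.prems e by (auto simp: irrefl_def)
  have new: "{a, b} \<notin> E" using insert.prems insert.hyps e by (auto simp: E_def doubleton_eq_iff)
  have "acyclic_graph E" using insert.prems(3) acyclic_graph_mono unfolding E' by blast
  moreover have "irrefl R" "R \<inter> R\<inverse> = {}" using insert.prems by (auto simp: irrefl_def)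
  ultimately obtain s where s: "\<forall>(i, j)\<in>R. s j - s i = \<delta> i j"
    using insert.IH unfolding E_def by blast
  let ?Q = "{(u, v). {u, v} \<in> E}"
  define K where "K = ?Q\<^sup>* `` {a}"
  \<comment> \<open>\<open>K\<close> is the component of \<open>a\<close>; everything outside it is
    shifted by the error of \<open>s\<close> on the new edge.\<close>
  define s' where "s' v = (if v \<in> K then s v else s v + (\<delta> a b - (s b - s a)))" for v
  have "a \<in> K" by (simp add: K_def)
  moreover have "b \<notin> K"
    using acyclic_graph_not_connected[OF _ new ab] insert.prems(3) unfolding E' K_def by auto
  ultimately have "s' b - s' a = \<delta> a b" by (simp add: s'_def)
  moreover have "s' j - s' i = \<delta> i j" if "(i, j) \<in> R" for i j
  proof -
    have "(i, j) \<in> ?Q" "(j, i) \<in> ?Q" using that by (auto simp: E_def)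
    then have "i \<in> K \<longleftrightarrow> j \<in> K" unfolding K_def by (meson Image_singleton_iff rtrancl.rtrancl_into_rtrancl)
    then show ?thesis using s that by (auto simp: s'_def)
  qed
  ultimately show ?case by (intro exI[of _ s']) (auto simp: e)
qed

section \<open>Inequalities of order-chain polytopes, and generated orders\<close>

text \<open>Every chain extends to a maximal one, and nonnegative coordinates make the sum
  grow.\<close>

lemma chain_sum_le_one:
  fixes x :: "real ^ 'n::finite"
  assumes x: "x \<in> chain_polytope q" and C: "C \<in> Chains q"
  shows "(\<Sum>i\<in>C. x $ i) \<le> 1"
proof -
  have "finite {D \<in> Chains q. C \<subseteq> D}" by simp
  then obtain D where D: "D \<in> Chains q" "C \<subseteq> D" "\<forall>D'\<in>{D \<in> Chains q. C \<subseteq> D}. D \<subseteq> D' \<longrightarrow> D = D'"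
    using finite_has_maximal2[of "{D \<in> Chains q. C \<subseteq> D}" C] C by auto
  then have "maximal_chain q D" unfolding maximal_chain_def by blast
  then have "(\<Sum>i\<in>D. x $ i) \<le> 1" using x by (simp add: chain_polytope_def)
  moreover have "(\<Sum>i\<in>C. x $ i) \<le> (\<Sum>i\<in>D. x $ i)"
    using x D by (intro sum_mono2) (auto simp: chain_polytope_def)
  ultimately show ?thesis by simp
qed

text \<open>Pairs of normal vector and bound, the format of
  \<open>extreme_point_eq_if_tight\<close>; their finiteness also makes the intersection a
  polyhedron.\<close>

definition order_chain_constraints :: "('n::finite) rel \<Rightarrow> 'n rel \<Rightarrow> ((real ^ 'n) \<times> real) set" where
  "order_chain_constraints p q =
     range (\<lambda>i. (axis i 1, 1)) \<union> range (\<lambda>i. (- axis i 1, 0)) \<union>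
     (\<lambda>(i, j). (axis j 1 - axis i 1, 0)) ` p \<union>
     (\<lambda>C. (\<Sum>i\<in>C. axis i 1, 1)) ` {C. maximal_chain q C}"

lemma finite_order_chain_constraints: "finite (order_chain_constraints p q)"
  unfolding order_chain_constraints_def by (intro finite_UnI finite_imageI) auto

lemma order_Int_chain_polytope_eq:
  "order_polytope p \<inter> chain_polytope q =
     {v. \<forall>(a, b)\<in>order_chain_constraints p q. a \<bullet> v \<le> b}"
  unfolding order_polytope_def chain_polytope_def order_chain_constraints_def
  by (auto simp: ball_Un inner_axis' inner_diff_left inner_sum_left)

lemma polytope_order_Int_chain: "polytope (order_polytope p \<inter> chain_polytope q)"
proof -
  let ?H = "order_chain_constraints p q"
  have "{v. \<forall>(a, b)\<in>?H. a \<bullet> v \<le> b} = \<Inter>((\<lambda>(a, b). {v. a \<bullet> v \<le> b}) ` ?H)"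
    by auto
  also have "polyhedron \<dots>"
    using finite_order_chain_constraints by (intro polyhedron_Inter) (auto simp: polyhedron_halfspace_le)
  finally have "polyhedron (order_polytope p \<inter> chain_polytope q)"
    by (simp add: order_Int_chain_polytope_eq)
  moreover have "order_polytope p \<inter> chain_polytope q \<subseteq> cbox 0 1"
    by (auto simp: order_polytope_def mem_box_cart)
  then have "bounded (order_polytope p \<inter> chain_polytope q)"
    using bounded_cbox bounded_subset by blast
  ultimately show ?thesis by (simp add: polytope_eq_bounded_polyhedron)
qed

text \<open>This lets generated orders inherit antisymmetry from \<open>r\<close>.\<close>

lemma generated_order_subset:
  assumes r: "trans r" "refl r"
  shows "generated_order r F \<subseteq> r"
proof -
  have "generated_order r F \<subseteq> r\<^sup>*"
    unfolding generated_order_def by (intro rtrancl_mono) (auto simp: cover_relation_def)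
  also have "r\<^sup>* = r" using r by (simp add: rtrancl_trancl_reflcl refl_on_def, auto)
  finally show ?thesis .
qed

lemma partial_order_UNIV:
  assumes "partial_order_on UNIV r"
  shows "refl r" "trans r" "antisym r"
  using assms by (auto simp: partial_order_on_def preorder_on_def)

lemma cover_relation_asym:
  assumes "antisym r"
  shows "cover_relation r \<inter> (cover_relation r)\<inverse> = {}" "irrefl (cover_relation r)"
  using assms by (auto simp: cover_relation_def irrefl_def antisym_def)

section \<open>Integrality of vertices for forests\<close>

lemma integral_if_acyclic:
  fixes r :: "('n::finite) rel"
  assumes po: "partial_order_on UNIV r" and acyc: "acyclic_graph (hasse_edges r)"
    and part: "edge_partition r (oE, cE)"
    and ext: "x extreme_point_of order_chain_polytope r (oE, cE)"
  shows "x $ i \<in> \<int>"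
proof -
  note r = partial_order_UNIV[OF po]
  define p where "p = generated_order r oE"
  define q where "q = generated_order r cE"
  let ?S = "order_polytope p \<inter> chain_polytope q"
  have S: "order_chain_polytope r (oE, cE) = ?S"
    by (simp add: order_chain_polytope_def p_def q_def)
  have q: "refl q" "trans q" "antisym q"
    using r generated_order_subset[of r cE]
    by (auto simp: q_def generated_order_def refl_rtrancl trans_rtrancl intro: antisym_subset)
  have x: "x \<in> order_polytope p" "x \<in> chain_polytope q"
    using ext S by (auto simp: extreme_point_of_def)
  then have x01: "0 \<le> x $ i" "x $ i \<le> 1" for i by (auto simp: order_polytope_def)
  obtain z where z: "\<And>i. 0 \<le> z i" "\<And>i. z i + x $ i \<le> 1"
    "\<And>i j. (i, j) \<in> q \<Longrightarrow> i \<noteq> j \<Longrightarrow> z i + x $ i \<le> z j"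
    and tile: "\<And>C t. C \<in> Chains q \<Longrightarrow> (\<Sum>i\<in>C. x $ i) = 1 \<Longrightarrow> 0 \<le> t \<Longrightarrow> t < 1 \<Longrightarrow>
       \<exists>i\<in>C. z i \<le> t \<and> t < z i + x $ i"
    using chain_offsets[OF q, of "\<lambda>i. x $ i"] x01 chain_sum_le_one[OF x(2)] by metis
  \<comment> \<open>The arc of \<open>i\<close> will start at \<open>- s i\<close>: order edges keep
    the starting point, and chain edges move it by the difference of the offsets
    \<open>z\<close>.\<close>
  have "\<exists>s. \<forall>(i, j)\<in>cover_relation r. s j - s i = (if {i, j} \<in> cE then z i - z j else 0)"
    using cover_relation_asym[OF r(3)] acyc unfolding hasse_edges_def by (intro forest_potential) auto
  then obtain s where s: "\<And>i j. (i, j) \<in> cover_relation r \<Longrightarrow>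
      s j - s i = (if {i, j} \<in> cE then z i - z j else 0)" by blast
  have sp: "s i = s j" if "(i, j) \<in> p" for i j
    using that unfolding p_def generated_order_def
  proof (induction rule: rtrancl_induct)
    case (step j k)
    then have "{j, k} \<notin> cE" using part by (auto simp: edge_partition_def)
    then show ?case using step s[of j k] by auto
  qed simp
  have sq: "s i + z i = s j + z j" if "(i, j) \<in> q" for i j
    using that unfolding q_def generated_order_def
  proof (induction rule: rtrancl_induct)
    case (step j k)
    then show ?case using s[of j k] by auto
  qed simp
  \<comment> \<open>\<open>y\<close> indicates the arcs that contain the point 0 of the circle,
    since \<open>frac (s i)\<close> is the forward distance from \<open>- s i\<close> to 0.\<close>
  define y :: "real ^ 'n" where "y = (\<chi> i. if frac (s i) < x $ i then 1 else 0)"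
  have y_in: "y $ i \<in> \<int>" for i by (simp add: y_def)
  \<comment> \<open>On a chain \<open>s i + z i\<close> is constant, so a single rotation carries
    all its arcs to the intervals from \<open>z i\<close> to \<open>z i + x $ i\<close>, and 0 to a
    common \<open>t\<close>.\<close>
  have y_chain: "\<exists>t. 0 \<le> t \<and> t < 1 \<and> (\<forall>i\<in>C. y $ i = (if z i \<le> t \<and> t < z i + x $ i then 1 else 0))"
    if "C \<in> Chains q" for C
  proof (cases "C = {}")
    case False
    then obtain m where m: "m \<in> C" by blast
    let ?c = "s m + z m"
    have "y $ i = (if z i \<le> frac ?c \<and> frac ?c < z i + x $ i then 1 else 0)" if "i \<in> C" for i
    proof -
      have "(i, m) \<in> q \<or> (m, i) \<in> q" using m that \<open>C \<in> Chains q\<close> by (auto simp: Chains_def)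
      then have "s i = ?c - z i" using sq by fastforce
      then show ?thesis using frac_diff_less_iff[OF z(1,2), of ?c i] by (simp add: y_def)
    qed
    then show ?thesis using frac_ge_0 frac_lt_1 by blast
  qed (auto intro: exI[of _ 0])
  have y_sum_le: "(\<Sum>i\<in>C. y $ i) \<le> 1" if C: "C \<in> Chains q" for C
  proof -
    obtain t where t: "\<forall>i\<in>C. y $ i = (if z i \<le> t \<and> t < z i + x $ i then 1 else 0)"
      using y_chain[OF C] by blast
    let ?A = "{i \<in> C. z i \<le> t \<and> t < z i + x $ i}"
    \<comment> \<open>Intervals of distinct comparable elements are disjoint, so at most one
      contains \<open>t\<close>.\<close>
    have "i = j" if "i \<in> ?A" "j \<in> ?A" for i j
    proof (rule ccontr)
      assume "i \<noteq> j"
      moreover have "(i, j) \<in> q \<or> (j, i) \<in> q" using that C by (auto simp: Chains_def)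
      ultimately show False using z(3)[of i j] z(3)[of j i] that by auto
    qed
    then have "card ?A \<le> 1" using card_le_Suc0_iff_eq[of ?A] by simp
    moreover have "(\<Sum>i\<in>C. y $ i) = (\<Sum>i\<in>?A. 1)"
      using t by (intro sum.mono_neutral_cong_right) auto
    ultimately show ?thesis by simp
  qed
  have y_sum_ge: "1 \<le> (\<Sum>i\<in>C. y $ i)" if C: "C \<in> Chains q" and sum1: "(\<Sum>i\<in>C. x $ i) = 1" for C
  proof -
    obtain t where t: "0 \<le> t" "t < 1"
      "\<forall>i\<in>C. y $ i = (if z i \<le> t \<and> t < z i + x $ i then 1 else 0)"
      using y_chain[OF C] by blast
    then obtain i where "i \<in> C" "z i \<le> t" "t < z i + x $ i"
      using tile[OF C sum1 t(1,2)] by blast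
    then have "y $ i = 1" "i \<in> C" using t by auto
    moreover have "y $ i \<le> (\<Sum>i\<in>C. y $ i)"
      using \<open>i \<in> C\<close> by (intro member_le_sum) (auto simp: y_def)
    ultimately show ?thesis by simp
  qed
  have "y \<in> ?S"
  proof -
    \<comment> \<open>Arcs with a common start are nested according to their lengths.\<close>
    have "y $ j \<le> y $ i" if "(i, j) \<in> p" for i j
      using sp[OF that] x(1) that by (fastforce simp: y_def order_polytope_def)
    moreover have "0 \<le> y $ i" "y $ i \<le> 1" for i by (simp_all add: y_def)
    ultimately show ?thesis
      using y_sum_le by (simp add: order_polytope_def chain_polytope_def maximal_chain_def)
  qed
  \<comment> \<open>An arc of length 1 contains every point and one of length 0 none; arcs with
    equal start and length coincide; the intervals of a chain of weight 1 cover every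
    \<open>t\<close> in \<open>[0, 1)\<close>.\<close>
  moreover have "a \<bullet> y = b" if "(a, b) \<in> order_chain_constraints p q" "a \<bullet> x = b" for a b
    using that(1) unfolding order_chain_constraints_def
  proof (elim UnE)
    assume "(a, b) \<in> range (\<lambda>i. (axis i 1, 1))"
    then show ?thesis using that(2) frac_lt_1 by (auto simp: inner_axis' y_def)
  next
    assume "(a, b) \<in> range (\<lambda>i. (- axis i 1, 0))"
    then show ?thesis using that(2) frac_ge_0 by (auto simp: inner_axis' y_def not_less)
  next
    assume "(a, b) \<in> (\<lambda>(i, j). (axis j 1 - axis i 1, 0)) ` p"
    then show ?thesis using that(2) sp by (auto simp: inner_axis' inner_diff_left y_def)
  next
    assume "(a, b) \<in> (\<lambda>C. (\<Sum>i\<in>C. axis i 1, 1)) ` {C. maximal_chain q C}"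
    then obtain C where C: "C \<in> Chains q" "a = (\<Sum>i\<in>C. axis i 1)" "b = 1"
      by (auto simp: maximal_chain_def)
    then show ?thesis using that(2) y_sum_le[of C] y_sum_ge[of C]
      by (auto simp: inner_sum_left inner_axis')
  qed
  ultimately have "y = x"
    using extreme_point_eq_if_tight[OF finite_order_chain_constraints
        ext[unfolded S order_Int_chain_polytope_eq]]
    unfolding order_Int_chain_polytope_eq mem_Collect_eq by metis
  with y_in show ?thesis by blast
qed

section \<open>A fractional vertex from a cycle\<close>

lemma cycle_gives_nonintegral_partition:
  fixes r :: "('n::finite) rel"
  assumes po: "partial_order_on UNIV r" and cyc: "graph_cycle (hasse_edges r) p"
  shows "\<exists>l. edge_partition r l \<and> \<not> integral_edge_partition r l"
proof -
  note r = partial_order_UNIV[OF po]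
  define n where "n = length p"
  have n: "3 \<le> n" and dist: "distinct p"
    and edge: "\<And>k. k < n \<Longrightarrow> {p ! k, p ! (Suc k mod n)} \<in> hasse_edges r"
    using cyc by (auto simp: graph_cycle_def n_def)
  then have "p \<noteq> []" by (auto simp: n_def)
  \<comment> \<open>Choosing the closing edge as the chain edge leaves the steps from
    \<open>k\<close> to \<open>Suc k\<close>, which involve no wrap-around.\<close>
  define e where "e = {p ! (n - 1), p ! 0}"
  have eH: "e \<in> hasse_edges r" using edge[of "n - 1"] n by (simp add: e_def)
  then obtain a b where e: "e = {a, b}" and ab: "(a, b) \<in> cover_relation r"
    by (auto simp: hasse_edges_def)
  have "a \<noteq> b" using ab by (simp add: cover_relation_def)
  define l where "l = (hasse_edges r - {e}, {e})"
  have l: "edge_partition r l" using eH by (auto simp: edge_partition_def l_def)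
  let ?o = "generated_order r (hasse_edges r - {e})"
  let ?c = "generated_order r {e}"
  \<comment> \<open>A cover relation holds in one direction only, so \<open>e\<close> contributes a
    single pair.\<close>
  have "{(i, j) \<in> cover_relation r. {i, j} \<in> {e}} = {(a, b)}"
    using ab cover_relation_asym[OF r(3)] by (auto simp: e doubleton_eq_iff)
  then have c: "?c = insert (a, b) Id"
    using \<open>a \<noteq> b\<close> by (auto simp: generated_order_def trancl_insert rtrancl_trancl_reflcl)
  let ?S = "order_chain_polytope r l"
  have S: "?S = order_polytope ?o \<inter> chain_polytope ?c"
    by (simp add: order_chain_polytope_def l_def)
  define F where "F = {v \<in> ?S. v $ a + v $ b = 1 \<and> (\<forall>(i, j)\<in>?o. v $ i = v $ j)}"
  have half: "(\<chi> i. 1 / 2) \<in> F"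
  proof -
    \<comment> \<open>Chains of \<open>?c\<close> have at most two elements, so halves sum to at
      most 1.\<close>
    have "(\<Sum>i\<in>C. 1 / 2 :: real) \<le> 1" if "C \<in> Chains ?c" for C
    proof -
      have "card C \<le> 2"
      proof (cases "C \<subseteq> {a, b}")
        case True
        then have "card C \<le> card {a, b}" by (intro card_mono) auto
        then show ?thesis by (simp add: \<open>a \<noteq> b\<close>)
      next
        case False
        then obtain i where "i \<in> C" "i \<notin> {a, b}" by blast
        then have "C \<subseteq> {i}" using that by (fastforce simp: Chains_def c)
        then have "card C \<le> card {i}" by (intro card_mono) auto
        then show ?thesis by simp
      qed
      then show ?thesis by simp
    qed
    then show ?thesis
      by (auto simp: F_def S order_polytope_def chain_polytope_def maximal_chain_def)
  qed
  have le: "v $ a + v $ b \<le> 1" "(i, j) \<in> ?o \<Longrightarrow> v $ j \<le> v $ i" if "v \<in> ?S" for v i j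
  proof -
    have "{a, b} \<in> Chains ?c" by (auto simp: Chains_def c)
    then show "v $ a + v $ b \<le> 1"
      using that chain_sum_le_one[of v ?c "{a, b}"] \<open>a \<noteq> b\<close> by (simp add: S)
    show "(i, j) \<in> ?o \<Longrightarrow> v $ j \<le> v $ i" using that by (simp add: S order_polytope_def)
  qed
  \<comment> \<open>A proper convex combination of two numbers bounded by \<open>c\<close> attains
    \<open>c\<close> only if both do. This gives the face property, with \<open>c\<close> equal to 1
    for the chain and 0 for the order differences.\<close>
  have tightD: "f = c \<and> g = c" if "(1 - u) * f + u * g = c" "f \<le> c" "g \<le> c" "0 < u" "u < 1"
    for u f g c :: real
  proof -
    have "(1 - u) * (c - f) + u * (c - g) = 0" using that by (simp add: algebra_simps)
    moreover have "0 \<le> (1 - u) * (c - f)" "0 \<le> u * (c - g)" using that by auto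
    ultimately have "(1 - u) * (c - f) = 0" "u * (c - g) = 0" by linarith+
    then show ?thesis using that by auto
  qed
  have polyS: "polytope ?S" by (simp add: S polytope_order_Int_chain)
  have convF: "convex F"
  proof -
    have "F = ?S \<inter> {v. (axis a 1 + axis b 1) \<bullet> v = 1} \<inter>
        (\<Inter>(i, j)\<in>?o. {v. (axis i 1 - axis j 1) \<bullet> v = 0})"
      by (auto simp: F_def inner_axis' inner_add_left inner_diff_left)
    also have "convex \<dots>"
      using polytope_imp_convex[OF polyS]
      by (intro convex_Int convex_INT) (auto simp: convex_hyperplane)
    finally show ?thesis .
  qed
  have faceF: "F face_of ?S"
    unfolding face_of_def
  proof (intro conjI ballI impI)
    show "F \<subseteq> ?S" by (auto simp: F_def)
    show "convex F" by (fact convF)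
  next
    fix f g v assume fg: "f \<in> ?S" "g \<in> ?S" and v: "v \<in> F" and "v \<in> open_segment f g"
    then obtain u where u: "0 < u" "u < 1" "v = (1 - u) *\<^sub>R f + u *\<^sub>R g"
      by (auto simp: in_segment)
    have 1: "f $ a + f $ b = 1 \<and> g $ a + g $ b = 1"
      using v u le(1)[OF fg(1)] le(1)[OF fg(2)]
      by (intro tightD[of u]) (auto simp: F_def algebra_simps)
    have 2: "f $ j - f $ i = 0 \<and> g $ j - g $ i = 0" if "(i, j) \<in> ?o" for i j
    proof -
      have "v $ j - v $ i = 0" using v that by (auto simp: F_def)
      then show ?thesis
        using u le(2)[OF fg(1) that] le(2)[OF fg(2) that]
        by (intro tightD[of u]) (auto simp: algebra_simps)
    qed
    show "f \<in> F" "g \<in> F" using fg 1 2 by (auto simp: F_def)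
  qed
  \<comment> \<open>A nonempty compact convex set has an extreme point, and an extreme point of a
    face is one of the whole polytope.\<close>
  have "compact F"
    using face_of_imp_compact faceF polyS polytope_imp_compact polytope_imp_convex by blast
  then obtain v where "v extreme_point_of F"
    using extreme_point_exists_convex convF half by blast
  then have v: "v extreme_point_of ?S" "v \<in> F"
    using extreme_point_of_face[OF faceF] by auto
  have "v $ (p ! k) = v $ (p ! 0)" if "k < n" for k
    using that
  proof (induction k)
    case (Suc k)
    have pk: "{p ! k, p ! Suc k} \<in> hasse_edges r" using edge[of k] Suc.prems by simp
    then obtain i j where ij: "{p ! k, p ! Suc k} = {i, j}" "(i, j) \<in> cover_relation r"
      by (auto simp: hasse_edges_def)
    \<comment> \<open>These inequalities rule out both ways of matching the two endpoints with those
      of \<open>e\<close>; the reversed match would need \<open>k = 0\<close> and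
      \<open>n = 2\<close>.\<close>
    have "p ! k \<noteq> p ! (n - 1)" "p ! Suc k \<noteq> p ! 0"
      using Suc.prems n nth_eq_iff_index_eq[OF dist, of k "n - 1"]
        nth_eq_iff_index_eq[OF dist, of "Suc k" 0] unfolding n_def by linarith+
    moreover have "p ! k \<noteq> p ! 0 \<or> p ! Suc k \<noteq> p ! (n - 1)"
      using Suc.prems n nth_eq_iff_index_eq[OF dist, of k 0]
        nth_eq_iff_index_eq[OF dist, of "Suc k" "n - 1"] unfolding n_def by linarith
    ultimately have "{p ! k, p ! Suc k} \<noteq> e" unfolding e_def doubleton_eq_iff by blast
    then have "{i, j} \<in> hasse_edges r - {e}" using ij(1) pk by simp
    then have "(i, j) \<in> ?o" unfolding generated_order_def using ij(2) by blast
    then have "v $ i = v $ j" using v(2) unfolding F_def by blast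
    then have "v $ (p ! k) = v $ (p ! Suc k)" using ij(1) unfolding doubleton_eq_iff by metis
    then show ?case using Suc by simp
  qed simp
  from this[of "n - 1"] have "v $ a = v $ b"
    using e n unfolding e_def doubleton_eq_iff by fastforce
  moreover have "v $ a + v $ b = 1" using v by (simp add: F_def)
  ultimately have "v $ a = 1 / 2" by simp
  moreover have "(1 / 2 :: real) \<notin> \<int>"
  proof
    assume "(1 / 2 :: real) \<in> \<int>"
    then obtain m :: int where "(1 / 2 :: real) = of_int m" by (auto elim: Ints_cases)
    then have "(of_int (2 * m) :: real) = of_int 1" by simp
    then have "2 * m = 1" by (simp only: of_int_eq_iff)
    then show False by presburger
  qed
  ultimately have "\<not> integral_edge_partition r l"
    using v(1) unfolding integral_edge_partition_def integral_polytope_def by metis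
  with l show ?thesis by blast
qed

theorem theorem2p1:
  fixes r :: "('n::finite) rel"
  assumes "partial_order_on UNIV r"
  shows "(\<forall>l. edge_partition r l \<longrightarrow> integral_edge_partition r l) \<longleftrightarrow> acyclic_graph (hasse_edges r)"
proof
  assume "\<forall>l. edge_partition r l \<longrightarrow> integral_edge_partition r l"
  then show "acyclic_graph (hasse_edges r)"
    using cycle_gives_nonintegral_partition[OF assms] unfolding acyclic_graph_def by blast
next
  assume "acyclic_graph (hasse_edges r)"
  then show "\<forall>l. edge_partition r l \<longrightarrow> integral_edge_partition r l"
    using integral_if_acyclic[OF assms] polytope_order_Int_chain
    unfolding integral_edge_partition_def integral_polytope_def
    by (metis order_chain_polytope_def surj_pair)
qed

end
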